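(* Let $\mathbf{m}=(m_1,\dots,m_n)\in\mathbb{Z}_{\ge0}^n$, let $P=[0,m_1]\times\cdots\times[0,m_n]\subseteq\mathbb{R}^n$, and let $\mathcal{A}$ be a finite set of integral affinographic hyperplanes in $\mathbb{R}^n$. Let $\Phi$ be the integral gain graph of $\mathcal{A}$. Then the number of integer points in $P\setminus\bigcup\mathcal{A}$ equals $$\sum_{B\in\mathrm{Lat}^b\Phi}\mu(\emptyset,B)\prod_{W_k\in\pi(B)}\Big(1+\min_{v_i\in W_k}\big[m_i+\varphi(B_{v_it_k})\big]-g_k\Big)^+,$$ where for each $W_k\in\pi(B)$, $t_k$ is a top vertex of the component of $B$ with vertex set $W_k$, and $g_k$ is the maximum gain of a path in $B$ within $W_k$.
   Context: An integral affinographic hyperplane is a hyperplane $x_j=x_i+a$ with $i\ne j$ and $a\in\mathbb{Z}$. The integral gain graph $\Phi$ of $\mathcal{A}$ has vertices $v_1,\dots,v_n$ and, for each hyperplane $x_j=x_i+a$ in $\mathcal{A}$, an edge from $v_i$ to $v_j$ with gain $a$ (its gain in the direction $v_j\to v_i$ is $-a$); the gain of a path is the sum of its edge gains. An edge set is balanced if every circle (cycle) in it has gain $0$; then all paths $B_{vw}$ in $B$ from $v$ to $w$ have the same gain $\varphi(B_{vw})$. A balanced set $B$ is closed if it contains every edge $e$ that lies in a balanced circle contained in $B\cup\{e\}$. $\mathrm{Lat}^b\Phi$ is the set of closed balanced edge sets ordered by inclusion and $\mu$ is its Möbius function. $\pi(B)$ is the partition of $\{v_1,\dots,v_n\}$ into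 vertex sets of connected components of $(V,B)$ (isolated vertices included). A top vertex of a component of balanced $B$ is a vertex $t$ such that no path in that component ending at $t$ has negative gain. $x^+=\max(x,0)$. *)

theory Defs
  imports "HOL-Analysis.Analysis"
begin

definition affinographic :: "'n::finite \<Rightarrow> int \<Rightarrow> 'n \<Rightarrow> (real ^ 'n) set" where
  "affinographic i a j = {x. x $ j = x $ i + of_int a}"

definition integral_affinographic :: "(real ^ 'n::finite) set \<Rightarrow> bool" where
  "integral_affinographic H \<longleftrightarrow> (\<exists>i j a. i \<noteq> j \<and> H = affinographic i a j)"

text \<open>
  A dart \<open>(i, a, j)\<close> is an edge traversed from \<open>i\<close> to \<open>j\<close>, with gain \<open>a\<close> in that direction.
  An (undirected) edge is the set of its two opposite darts, so parallel edges are distinguished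
  by their gains.  The vertex set of a gain graph is the whole type \<open>'v\<close>; a gain graph is given
  by its edge set.
\<close>

type_synonym 'v dart = "'v \<times> int \<times> 'v"
type_synonym 'v edge = "'v dart set"

definition src :: "'v dart \<Rightarrow> 'v" where "src d = fst d"
definition dart_gain :: "'v dart \<Rightarrow> int" where "dart_gain d = fst (snd d)"
definition tgt :: "'v dart \<Rightarrow> 'v" where "tgt d = snd (snd d)"

definition rev_dart :: "'v dart \<Rightarrow> 'v dart" where
  "rev_dart d = (tgt d, - dart_gain d, src d)"

definition dart_edge :: "'v dart \<Rightarrow> 'v edge" where
  "dart_edge d = {d, rev_dart d}"

definition integral_gain_graph :: "(real ^ 'n::finite) set set \<Rightarrow> 'n edge set" where
  "integral_gain_graph \<A> = {dart_edge (i, a, j) | i a j. i \<noteq> j \<and> affinographic i a j \<in> \<A>}"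

fun walk :: "'v \<Rightarrow> 'v dart list \<Rightarrow> 'v \<Rightarrow> bool" where
  "walk u [] w \<longleftrightarrow> u = w"
| "walk u (d # p) w \<longleftrightarrow> src d = u \<and> walk (tgt d) p w"

definition edges :: "'v dart list \<Rightarrow> 'v edge set" where
  "edges p = dart_edge ` set p"

definition gain :: "'v dart list \<Rightarrow> int" where
  "gain p = (\<Sum>d\<leftarrow>p. dart_gain d)"

text \<open>Paths do not repeat vertices; the trivial path \<open>[]\<close> from a vertex to itself is a path.\<close>

definition path_in :: "'v edge set \<Rightarrow> 'v \<Rightarrow> 'v dart list \<Rightarrow> 'v \<Rightarrow> bool" where
  "path_in B u p w \<longleftrightarrow> walk u p w \<and> edges p \<subseteq> B \<and> distinct (u # map tgt p)"

text \<open>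
  A circle is given by a closed walk around it.  The condition on edges only matters for length 2,
  where it rules out going back along the same edge; two parallel edges do form a circle.
\<close>

definition circle :: "'v dart list \<Rightarrow> bool" where
  "circle p \<longleftrightarrow> p \<noteq> [] \<and> (\<exists>u. walk u p u) \<and> distinct (map src p) \<and> distinct (map dart_edge p)"

definition balanced :: "'v edge set \<Rightarrow> bool" where
  "balanced B \<longleftrightarrow> (\<forall>p. circle p \<and> edges p \<subseteq> B \<longrightarrow> gain p = 0)"

definition closed_in :: "'v edge set \<Rightarrow> 'v edge set \<Rightarrow> bool" where
  "closed_in E B \<longleftrightarrow>
     (\<forall>e\<in>E. (\<exists>p. circle p \<and> gain p = 0 \<and> e \<in> edges p \<and> edges p \<subseteq> B \<union> {e}) \<longrightarrow> e \<in> B)"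

definition Latb :: "'v edge set \<Rightarrow> 'v edge set set" where
  "Latb E = {B. B \<subseteq> E \<and> balanced B \<and> closed_in E B}"

definition path_gain :: "'v edge set \<Rightarrow> 'v \<Rightarrow> 'v \<Rightarrow> int" where
  "path_gain B v w = (THE g. \<exists>p. path_in B v p w \<and> gain p = g)"

definition components_partition :: "'v edge set \<Rightarrow> 'v set set" where
  "components_partition B = UNIV // {(u, w). \<exists>p. path_in B u p w}"

definition top_vertex :: "'v edge set \<Rightarrow> 'v set \<Rightarrow> 'v \<Rightarrow> bool" where
  "top_vertex B W t \<longleftrightarrow> t \<in> W \<and> (\<forall>v\<in>W. \<forall>p. path_in B v p t \<longrightarrow> \<not> gain p < 0)"

definition max_gain :: "'v edge set \<Rightarrow> 'v set \<Rightarrow> int" where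
  "max_gain B W = Max {gain p | u p w. u \<in> W \<and> w \<in> W \<and> path_in B u p w}"

function poset_moebius :: "'a::order set \<Rightarrow> 'a \<Rightarrow> 'a \<Rightarrow> int" where
  "poset_moebius L x y =
     (if finite L \<and> x \<in> L \<and> y \<in> L \<and> x \<le> y
      then if x = y then 1 else - (\<Sum>z\<in>{z\<in>L. x \<le> z \<and> z < y}. poset_moebius L x z)
      else 0)"
  by pat_completeness auto
termination
proof (relation "Wellfounded.measure (\<lambda>(L, x, y). card {z\<in>L. z < y})", goal_cases)
  case (2 L x y z)
  then have "{w\<in>L. w < z} \<subset> {w\<in>L. w < y}"
    by auto
  with 2 show ?case
    by (auto intro!: psubset_card_mono)
qed simp

declare poset_moebius.simps [simp del]

lemma walk_append: "walk u (p @ q) w \<longleftrightarrow> (\<exists>v. walk u p v \<and> walk v q w)"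
  by (induction p arbitrary: u) auto

lemma gain_simps [simp]:
  "gain [] = 0" "gain (d # p) = dart_gain d + gain p" "gain (p @ q) = gain p + gain q"
  by (auto simp: gain_def)

lemma edges_simps [simp]:
  "edges [] = {}" "edges (d # p) = insert (dart_edge d) (edges p)"
  "edges (p @ q) = edges p \<union> edges q"
  by (auto simp: edges_def)

lemma rev_dart_simps [simp]:
  "src (rev_dart d) = tgt d" "tgt (rev_dart d) = src d"
  "dart_gain (rev_dart d) = - dart_gain d" "rev_dart (rev_dart d) = d"
  by (auto simp: rev_dart_def src_def tgt_def dart_gain_def)

lemma dart_edge_rev_dart [simp]: "dart_edge (rev_dart d) = dart_edge d"
  by (auto simp: dart_edge_def)

lemma dart_edge_eq_iff: "dart_edge d = dart_edge d' \<longleftrightarrow> d' = d \<or> d' = rev_dart d"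
  by (auto simp: dart_edge_def doubleton_eq_iff)

definition rev_walk :: "'v dart list \<Rightarrow> 'v dart list" where
  "rev_walk p = rev (map rev_dart p)"

lemma rev_walk:
  "walk u p w \<Longrightarrow> walk w (rev_walk p) u" "edges (rev_walk p) = edges p"
  "gain (rev_walk p) = - gain p"
  by (induction p arbitrary: u) (auto simp: rev_walk_def walk_append)

lemma not_distinct_map_decomp:
  assumes "\<not> distinct (map f p)"
  obtains a d b d' c where "p = a @ d # b @ d' # c" "f d = f d'"
proof -
  have "\<exists>a d b d' c. p = a @ d # b @ d' # c \<and> f d = f d'"
    using assms
  proof (induction p)
    case (Cons x p)
    show ?case
    proof (cases "f x \<in> f ` set p")
      case True
      then obtain x' where "x' \<in> set p" "f x = f x'"
        by blast
      moreover from this obtain b c where "p = b @ x' # c"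
        by (meson split_list)
      ultimately have "x # p = [] @ x # b @ x' # c \<and> f x = f x'"
        by simp
      then show ?thesis
        by blast
    next
      case False
      then obtain a d b d' c where "p = a @ d # b @ d' # c" "f d = f d'"
        using Cons by auto
      then have "x # p = (x # a) @ d # b @ d' # c \<and> f d = f d'"
        by simp
      then show ?thesis
        by blast
    qed
  qed simp
  then show thesis
    using that by blast
qed

lemma closed_walk_gain:
  assumes "balanced B" "walk u p u" "edges p \<subseteq> B"
  shows "gain p = 0"
  using assms(2,3)
proof (induction "length p" arbitrary: u p rule: less_induct)
  case less
  show ?case
  proof (cases "distinct (map src p)")
    case False
    then obtain a d b d' c where p: "p = a @ d # b @ d' # c" and "src d = src d'"
      by (rule not_distinct_map_decomp)
    then have "walk u (a @ d' # c) u" "walk (src d) (d # b) (src d)"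
      using less.prems by (auto simp: walk_append)
    moreover have "edges (a @ d' # c) \<subseteq> B" "edges (d # b) \<subseteq> B"
      using less.prems by (auto simp: p)
    ultimately have "gain (a @ d' # c) = 0" "gain (d # b) = 0"
      using less.hyps[of "a @ d' # c" u] less.hyps[of "d # b" "src d"] by (simp_all add: p)
    then show ?thesis
      by (simp add: p)
  next
    case src: True
    show ?thesis
    proof (cases "distinct (map dart_edge p)")
      case True
      then show ?thesis
        using src less.prems assms(1) by (cases "p = []") (auto simp: balanced_def circle_def)
    next
      case False
      then obtain a d b d' c where p: "p = a @ d # b @ d' # c" and "dart_edge d = dart_edge d'"
        by (rule not_distinct_map_decomp)
      then have d': "d' = rev_dart d"
        using src by (auto simp: dart_edge_eq_iff)
      have w: "walk u a (src d)" "walk (tgt d) b (tgt d)" "walk (src d) c u"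
        using less.prems by (auto simp: p d' walk_append)
      have "b = []"
        using w src by (cases b) (auto simp: p d')
      moreover have "c = []"
        using w src by (cases c) (auto simp: p d')
      moreover from this have "a = []"
        using w src by (cases a) (auto simp: p d')
      ultimately show ?thesis
        by (simp add: p d')
    qed
  qed
qed

lemma path_gain_eq:
  assumes "balanced B" "path_in B v p w"
  shows "path_gain B v w = gain p"
proof -
  have uniq: "gain q = gain p" if "path_in B v q w" for q
  proof -
    have "walk v (q @ rev_walk p) v" "edges (q @ rev_walk p) \<subseteq> B"
      using that assms(2) by (auto simp: path_in_def walk_append rev_walk(2) intro: rev_walk(1))
    then have "gain (q @ rev_walk p) = 0"
      by (rule closed_walk_gain[OF assms(1)])
    then show ?thesis
      by (simp add: rev_walk(3))
  qed
  show ?thesis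
    unfolding path_gain_def by (rule the_equality) (use assms(2) uniq in blast)+
qed

lemma top_vertex_exists:
  fixes B :: "'v::finite edge set"
  assumes "balanced B" "W \<in> components_partition B"
  shows "\<exists>t. top_vertex B W t"
proof -
  obtain r where W: "W = {w. \<exists>p. path_in B r p w}"
    using assms(2) by (auto simp: components_partition_def quotient_def)
  have "path_in B r [] r"
    by (simp add: path_in_def)
  then have "path_gain B r ` W \<noteq> {}"
    by (auto simp: W)
  then have "Max (path_gain B r ` W) \<in> path_gain B r ` W"
    by (intro Max_in) auto
  then obtain t where t1: "t \<in> W" "Max (path_gain B r ` W) = path_gain B r t"
    by blast
  have t: "path_gain B r v \<le> path_gain B r t" if "v \<in> W" for v
    using t1 that Max_ge[of "path_gain B r ` W" "path_gain B r v"] by simp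
  have "\<not> gain p < 0" if "v \<in> W" "path_in B v p t" for v p
  proof -
    obtain q s where q: "path_in B r q v" and s: "path_in B r s t"
      using t1(1) \<open>v \<in> W\<close> by (auto simp: W)
    have "walk r (q @ p @ rev_walk s) r" "edges (q @ p @ rev_walk s) \<subseteq> B"
      using that(2) q s by (auto simp: path_in_def walk_append rev_walk(2) intro: rev_walk(1))
    then have "gain (q @ p @ rev_walk s) = 0"
      by (rule closed_walk_gain[OF assms(1)])
    then show ?thesis
      using t[OF \<open>v \<in> W\<close>] path_gain_eq[OF assms(1) q] path_gain_eq[OF assms(1) s]
      by (simp add: rev_walk(3))
  qed
  with t1(1) show ?thesis
    by (auto simp: top_vertex_def)
qed

end

theory Submission
  imports Defs
begin

text \<open>
  For an integer point \<open>x\<close>, the edges whose hyperplanes contain \<open>x\<close> form a closed balanced set, and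
  it is empty iff \<open>x\<close> avoids the arrangement.  Moebius inversion over \<open>Lat\<^sup>b \<Phi>\<close> therefore reduces
  the theorem to counting the points of the box on all the hyperplanes of a balanced set \<open>B\<close>.  Such a
  point is determined by its coordinates at the top vertices \<open>t\<close>, since \<open>x\<^sub>i = x\<^sub>t - \<phi>(B\<^sub>i\<^sub>t)\<close>; and
  \<open>0 \<le> x\<^sub>i \<le> m\<^sub>i\<close> says that \<open>x\<^sub>t\<close> lies between \<open>\<phi>(B\<^sub>i\<^sub>t)\<close>, whose maximum over the component is
  the maximum gain, and \<open>m\<^sub>i + \<phi>(B\<^sub>i\<^sub>t)\<close>.
\<close>

section \<open>Integer points as potentials, and gains of walks\<close>

text \<open>Quantifying over the darts of the edge avoids choosing an orientation. For opposite
  darts the two conditions are equivalent, because reversal negates the gain.\<close>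

definition satisfies :: "('v \<Rightarrow> int) \<Rightarrow> 'v edge \<Rightarrow> bool" where
  "satisfies x e \<longleftrightarrow> (\<forall>d\<in>e. x (tgt d) = x (src d) + dart_gain d)"

lemma satisfies_dart_edge:
  "satisfies x (dart_edge d) \<longleftrightarrow> x (tgt d) = x (src d) + dart_gain d"
  by (auto simp: satisfies_def dart_edge_def)

lemma satisfies_walk:
  assumes "walk u p w" "\<And>e. e \<in> edges p \<Longrightarrow> satisfies x e"
  shows "x w = x u + gain p"
  using assms
proof (induction p arbitrary: u)
  case (Cons d p)
  then have "x w = x (tgt d) + gain p" "satisfies x (dart_edge d)"
    by auto
  then show ?case
    using Cons.prems(1) by (simp add: satisfies_dart_edge)
qed simp

lemma path_in_suffix:
  assumes "path_in B v p w" "u \<in> set (v # map tgt p)"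
  shows "\<exists>q. path_in B u q w"
  using assms
proof (induction p arbitrary: v)
  case Nil
  then show ?case by auto
next
  case (Cons d p)
  show ?case
  proof (cases "u = v")
    case True
    then show ?thesis using Cons.prems by blast
  next
    case False
    have "path_in B (tgt d) p w"
      using Cons.prems(1) by (auto simp: path_in_def)
    moreover have "u \<in> set (tgt d # map tgt p)"
      using Cons.prems(2) False by auto
    ultimately show ?thesis by (rule Cons.IH)
  qed
qed

text \<open>Loop erasure: if the first vertex recurs on the path found for the rest of the walk, the
  tail of that path from this vertex is taken instead. Gains are not tracked here; balance recovers
  them in \<open>walk_gain_eq_path_gain\<close>.\<close>

lemma walk_imp_path_in:
  assumes "walk u p w" "edges p \<subseteq> B"
  shows "\<exists>q. path_in B u q w"
  using assms
proof (induction p arbitrary: u)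
  case Nil
  then have "path_in B u [] w" by (simp add: path_in_def)
  then show ?case by blast
next
  case (Cons d p)
  then obtain q where q: "path_in B (tgt d) q w" by auto
  show ?case
  proof (cases "u \<in> set (tgt d # map tgt q)")
    case True
    then show ?thesis using path_in_suffix[OF q] by blast
  next
    case False
    then have "path_in B u (d # q) w"
      using q Cons.prems by (auto simp: path_in_def)
    then show ?thesis by blast
  qed
qed

text \<open>Following the walk and returning along a path gives a closed walk, whose gain is 0 by
  balance. This lets later arguments concatenate freely without checking that vertices are
  distinct.\<close>

lemma walk_gain_eq_path_gain:
  assumes "balanced B" "walk u p w" "edges p \<subseteq> B"
  shows "gain p = path_gain B u w"
proof -
  obtain q where q: "path_in B u q w"
    using walk_imp_path_in[OF assms(2,3)] by blast
  then have "walk w (rev_walk q) u" "edges (rev_walk q) \<subseteq> B"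
    by (simp_all add: path_in_def rev_walk)
  then have "walk u (p @ rev_walk q) u" "edges (p @ rev_walk q) \<subseteq> B"
    using assms(2,3) by (auto simp: walk_append)
  then have "gain (p @ rev_walk q) = 0"
    by (rule closed_walk_gain[OF assms(1)])
  then show ?thesis
    using path_gain_eq[OF assms(1) q] by (simp add: rev_walk(3))
qed

section \<open>Components and additivity of path gains\<close>

definition conn :: "'v edge set \<Rightarrow> ('v \<times> 'v) set" where
  "conn B = {(u, w). \<exists>p. path_in B u p w}"

text \<open>Walks, unlike paths, are closed under concatenation, which is what transitivity and
  additivity of gains rely on.\<close>

lemma conn_iff_walk: "(u, w) \<in> conn B \<longleftrightarrow> (\<exists>p. walk u p w \<and> edges p \<subseteq> B)"
  unfolding conn_def using walk_imp_path_in[of u _ w B] by (auto simp: path_in_def)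

lemma equiv_conn: "equiv UNIV (conn B)"
proof (rule equivI)
  show "refl_on UNIV (conn B)"
    by (rule refl_onI) (auto simp: conn_iff_walk intro!: exI[of _ "[]"])
  show "sym (conn B)"
    by (rule symI) (metis conn_iff_walk rev_walk(1,2))
  show "trans (conn B)"
  proof (rule transI)
    fix u v w assume "(u, v) \<in> conn B" "(v, w) \<in> conn B"
    then obtain p q where "walk u p v" "edges p \<subseteq> B" "walk v q w" "edges q \<subseteq> B"
      by (auto simp: conn_iff_walk)
    then have "walk u (p @ q) w" "edges (p @ q) \<subseteq> B"
      by (auto simp: walk_append)
    then show "(u, w) \<in> conn B"
      unfolding conn_iff_walk by blast
  qed
qed simp

lemma components_partition_conn: "components_partition B = UNIV // conn B"
  by (simp add: components_partition_def conn_def)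

lemma path_gain_add:
  assumes "balanced B" "(u, v) \<in> conn B" "(v, w) \<in> conn B"
  shows "path_gain B u w = path_gain B u v + path_gain B v w"
proof -
  obtain p q where pq: "walk u p v" "edges p \<subseteq> B" "walk v q w" "edges q \<subseteq> B"
    using assms(2,3) by (auto simp: conn_iff_walk)
  then have "walk u (p @ q) w" "edges (p @ q) \<subseteq> B"
    by (auto simp: walk_append)
  from walk_gain_eq_path_gain[OF assms(1) this] show ?thesis
    using walk_gain_eq_path_gain[OF assms(1)] pq by simp
qed

lemma component_conn:
  assumes "W \<in> components_partition B" "u \<in> W" "v \<in> W"
  shows "(u, v) \<in> conn B"
proof -
  have "W \<in> UNIV // conn B"
    using assms(1) by (simp add: components_partition_conn)
  from quotient_eq_iff[OF equiv_conn this this assms(2,3)] show ?thesis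
    by simp
qed

section \<open>Top vertices and maximum gains\<close>

lemma path_gain_top_nonneg:
  assumes "balanced B" "W \<in> components_partition B" "top_vertex B W t" "v \<in> W"
  shows "0 \<le> path_gain B v t"
proof -
  have "(v, t) \<in> conn B"
    using assms component_conn by (auto simp: top_vertex_def)
  then obtain p where p: "path_in B v p t" by (auto simp: conn_def)
  then show ?thesis
    using assms(3,4) path_gain_eq[OF assms(1) p] by (force simp: top_vertex_def)
qed

text \<open>Continuing from \<open>w\<close> to the top vertex adds a nonnegative gain, so the gain
  from \<open>u\<close> to \<open>w\<close> is at most the gain from \<open>u\<close> to
  \<open>t\<close>. Hence paths ending at \<open>t\<close> suffice for the maximum.\<close>

lemma max_gain_eq:
  fixes B :: "'v::finite edge set"
  assumes "balanced B" "W \<in> components_partition B" "top_vertex B W t"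
  shows "max_gain B W = (MAX i\<in>W. path_gain B i t)"
proof -
  let ?S = "{gain p | u p w. u \<in> W \<and> w \<in> W \<and> path_in B u p w}"
  have t: "t \<in> W" using assms(3) by (simp add: top_vertex_def)
  \<comment> \<open>By balance a gain depends only on the two ends of the path, and there are
    finitely many pairs of vertices.\<close>
  have "?S \<subseteq> (\<lambda>(u, w). path_gain B u w) ` UNIV"
    using path_gain_eq[OF assms(1), symmetric] by fastforce
  then have fin: "finite ?S"
    by (rule finite_subset) simp
  have mem: "path_gain B i t \<in> ?S" if "i \<in> W" for i
  proof -
    have "(i, t) \<in> conn B"
      using assms(2) that t by (rule component_conn)
    then obtain p where "path_in B i p t"
      by (auto simp: conn_def)
    then show ?thesis
      using path_gain_eq[OF assms(1)] that t by fastforce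
  qed
  have le: "s \<le> (MAX i\<in>W. path_gain B i t)" if "s \<in> ?S" for s
  proof -
    obtain u p w where s: "s = gain p" "u \<in> W" "w \<in> W" "path_in B u p w"
      using \<open>s \<in> ?S\<close> by blast
    have "path_gain B u t = path_gain B u w + path_gain B w t"
      using s t by (intro path_gain_add assms(1) component_conn[OF assms(2)])
    moreover have "0 \<le> path_gain B w t"
      using path_gain_top_nonneg[OF assms] s by blast
    ultimately have "s \<le> path_gain B u t"
      using s path_gain_eq[OF assms(1)] by auto
    also have "\<dots> \<le> (MAX i\<in>W. path_gain B i t)"
      using s by (intro Max_ge) auto
    finally show ?thesis .
  qed
  show ?thesis
    unfolding max_gain_def
  proof (rule antisym)
    show "Max ?S \<le> (MAX i\<in>W. path_gain B i t)"
      using le mem[OF t] fin by (subst Max_le_iff) blast+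
    show "(MAX i\<in>W. path_gain B i t) \<le> Max ?S"
      using mem t fin by (subst Max_le_iff) (auto intro!: Max_ge)
  qed
qed

section \<open>Box points on all hyperplanes of a balanced set\<close>

text \<open>The coordinates at the top vertices can be chosen independently, one per component, each
  from the integer interval \<open>?I W\<close>. The points thus biject with a product of
  intervals.\<close>

lemma card_satisfying_box:
  fixes B :: "'v::finite edge set" and m :: "'v \<Rightarrow> int"
  assumes "balanced B" "B \<subseteq> range dart_edge"
    and top: "\<And>W. W \<in> components_partition B \<Longrightarrow> top_vertex B W (t W)"
  shows "int (card {x. (\<forall>i. 0 \<le> x i \<and> x i \<le> m i) \<and> (\<forall>e\<in>B. satisfies x e)}) =
    (\<Prod>W\<in>components_partition B.
       max 0 (1 + (MIN i\<in>W. m i + path_gain B i (t W)) - max_gain B W))"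
proof -
  let ?P = "components_partition B"
  let ?I = "\<lambda>W. {max_gain B W..(MIN i\<in>W. m i + path_gain B i (t W))}"
  let ?X = "{x. (\<forall>i. 0 \<le> x i \<and> x i \<le> m i) \<and> (\<forall>e\<in>B. satisfies x e)}"
  define cls where "cls i = conn B `` {i}" for i
  \<comment> \<open>\<open>h\<close> reads off the coordinates at the top vertices, restricted to
    \<open>?P\<close> so that it lands in the function space \<open>PiE\<close>. Its inverse
    \<open>k\<close> propagates these values back along the gains.\<close>
  define h where "h x = (\<lambda>W\<in>?P. x (t W))" for x :: "'v \<Rightarrow> int"
  define k where "k z = (\<lambda>i. z (cls i) - path_gain B i (t (cls i)))" for z :: "'v set \<Rightarrow> int"
  have tW: "t W \<in> W" if "W \<in> ?P" for W
    using top[OF that] by (simp add: top_vertex_def)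
  have cls_P: "cls i \<in> ?P" for i
    by (simp add: cls_def components_partition_conn quotientI)
  have cls_self: "i \<in> cls i" for i
    unfolding cls_def by (rule equiv_class_self[OF equiv_conn]) simp
  have cls_eq: "cls i = W" if "W \<in> ?P" "i \<in> W" for i W
    using that cls_P[of i] cls_self[of i] quotient_disj[OF equiv_conn]
    by (metis IntI components_partition_conn empty_iff)
  \<comment> \<open>By \<open>max_gain_eq\<close> both ends of the interval are extrema over
    \<open>W\<close>, so membership splits into one pair of bounds per vertex.\<close>
  have memI: "z \<in> ?I W \<longleftrightarrow> (\<forall>i\<in>W. path_gain B i (t W) \<le> z \<and> z \<le> m i + path_gain B i (t W))"
    if "W \<in> ?P" for W z
  proof -
    have "finite W" "W \<noteq> {}" using tW[OF that] by auto
    then show ?thesis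
      by (auto simp: max_gain_eq[OF assms(1) that top[OF that]])
  qed
  have conn_top: "(i, t (cls i)) \<in> conn B" for i
    by (rule component_conn[OF cls_P cls_self tW[OF cls_P]])
  have coord: "x i = x (t (cls i)) - path_gain B i (t (cls i))" if "x \<in> ?X" for x i
  proof -
    obtain p where p: "walk i p (t (cls i))" "edges p \<subseteq> B"
      using conn_top[of i] by (auto simp: conn_iff_walk)
    then have "x (t (cls i)) = x i + gain p"
      using that by (intro satisfies_walk) auto
    then show ?thesis
      using walk_gain_eq_path_gain[OF assms(1) p] by simp
  qed
  have "bij_betw h ?X (PiE ?P ?I)"
  proof (rule bij_betw_byWitness[where f' = k])
    show "\<forall>x\<in>?X. k (h x) = x"
      using coord cls_P by (auto simp: k_def h_def fun_eq_iff)
    show "\<forall>z\<in>PiE ?P ?I. h (k z) = z"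
    proof
      fix z assume z: "z \<in> PiE ?P ?I"
      have "h (k z) W = z W" for W
      proof (cases "W \<in> ?P")
        case True
        have "path_gain B (t W) (t W) = 0"
          using walk_gain_eq_path_gain[OF assms(1), of "t W" "[]" "t W"] by simp
        then show ?thesis
          using True cls_eq[OF True tW[OF True]] by (simp add: h_def k_def)
      next
        case False
        then show ?thesis using PiE_arb[OF z] by (simp add: h_def)
      qed
      then show "h (k z) = z" by (rule ext)
    qed
    show "h ` ?X \<subseteq> PiE ?P ?I"
    proof clarify
      fix x assume box: "\<forall>i. 0 \<le> x i \<and> x i \<le> m i" and "\<forall>e\<in>B. satisfies x e"
      then have "x \<in> ?X" by blast
      note c = coord[OF this]
      have "x (t W) \<in> ?I W" if "W \<in> ?P" for W
      proof (subst memI[OF that], intro ballI)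
        fix i assume "i \<in> W"
        then have "x i = x (t W) - path_gain B i (t W)"
          using c[of i] cls_eq[OF that] by simp
        with box show "path_gain B i (t W) \<le> x (t W) \<and> x (t W) \<le> m i + path_gain B i (t W)"
          by (smt (verit))
      qed
      then show "h x \<in> PiE ?P ?I"
        unfolding h_def by (intro restrict_PiE_iff[THEN iffD2] ballI)
    qed
    show "k ` PiE ?P ?I \<subseteq> ?X"
    proof (intro image_subsetI CollectI conjI allI ballI)
      fix z i assume "z \<in> PiE ?P ?I"
      then have "z (cls i) \<in> ?I (cls i)"
        using cls_P by (rule PiE_mem)
      then have "path_gain B i (t (cls i)) \<le> z (cls i) \<and> z (cls i) \<le> m i + path_gain B i (t (cls i))"
        using cls_self unfolding memI[OF cls_P] by blast
      then show "0 \<le> k z i" "k z i \<le> m i" by (simp_all add: k_def)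
    next
      fix z e assume "e \<in> B"
      \<comment> \<open>Both ends of the edge lie in one component, so \<open>k z\<close> uses the
        same top value at both. By additivity the two coordinates differ by the path gain between
        the ends, which is the gain of \<open>d\<close>.\<close>
      then obtain d where d: "e = dart_edge d" using assms(2) by blast
      have w: "walk (src d) [d] (tgt d)" "edges [d] \<subseteq> B"
        using \<open>e \<in> B\<close> d by auto
      then have st: "(src d, tgt d) \<in> conn B"
        unfolding conn_iff_walk by blast
      then have eq: "cls (src d) = cls (tgt d)"
        unfolding cls_def by (rule equiv_class_eq[OF equiv_conn])
      have "path_gain B (src d) (t (cls (tgt d))) =
          path_gain B (src d) (tgt d) + path_gain B (tgt d) (t (cls (tgt d)))"
        by (rule path_gain_add[OF assms(1) st conn_top])
      then show "satisfies (k z) e"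
        using walk_gain_eq_path_gain[OF assms(1) w]
        by (simp add: d satisfies_dart_edge k_def eq)
    qed
  qed
  then have "card ?X = (\<Prod>W\<in>?P. card (?I W))"
    by (simp only: bij_betw_same_card card_PiE[OF finite])
  then show ?thesis
    \<comment> \<open>An integer interval has \<open>nat (1 + upper - lower)\<close> elements; the
      truncation at 0 is the positive part.\<close>
    by (simp add: algebra_simps) (auto simp: max_def intro!: prod.cong)
qed

section \<open>Moebius inversion\<close>

text \<open>For \<open>a < c\<close> the recursion makes the term at \<open>c\<close> the negative
  of the sum over all smaller terms, so the whole interval sums to 0.\<close>

lemma sum_poset_moebius:
  assumes "finite L" "a \<in> L" "c \<in> L" "a \<le> c"
  shows "(\<Sum>b\<in>{b\<in>L. a \<le> b \<and> b \<le> c}. poset_moebius L a b) = (if c = a then 1 else 0)"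
proof -
  have "{b\<in>L. a \<le> b \<and> b \<le> c} = insert c {b\<in>L. a \<le> b \<and> b < c}"
    using assms by auto
  then have "(\<Sum>b\<in>{b\<in>L. a \<le> b \<and> b \<le> c}. poset_moebius L a b) =
      poset_moebius L a c + (\<Sum>b\<in>{b\<in>L. a \<le> b \<and> b < c}. poset_moebius L a b)"
    using assms(1) by simp
  moreover have "(\<Sum>b\<in>{b\<in>L. a \<le> b \<and> b < a}. poset_moebius L a b) = 0"
    by (rule sum.neutral) auto
  ultimately show ?thesis
    using assms poset_moebius.simps[of L a c] by auto
qed

text \<open>Exchanging the sums, each \<open>x\<close> contributes the sum of Moebius values over
  the interval from \<open>a\<close> to \<open>f x\<close>, which is 1 if \<open>f x = a\<close> and
  0 otherwise.\<close>

lemma moebius_inversion_count: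
  fixes L :: "'a::order set"
  assumes "finite L" "a \<in> L" "finite X" "\<And>x. x \<in> X \<Longrightarrow> f x \<in> L" "\<And>b. b \<in> L \<Longrightarrow> a \<le> b"
  shows "int (card {x\<in>X. f x = a}) = (\<Sum>b\<in>L. poset_moebius L a b * int (card {x\<in>X. b \<le> f x}))"
proof -
  have "(\<Sum>b\<in>L. poset_moebius L a b * int (card {x\<in>X. b \<le> f x})) =
      (\<Sum>b\<in>L. \<Sum>x\<in>X. if b \<le> f x then poset_moebius L a b else 0)"
    using assms(3) by (auto simp: sum.If_cases Int_def intro!: sum.cong)
  also have "\<dots> = (\<Sum>x\<in>X. \<Sum>b\<in>L. if b \<le> f x then poset_moebius L a b else 0)"
    by (rule sum.swap)
  also have "\<dots> = (\<Sum>x\<in>X. if f x = a then 1 else 0)"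
  proof (rule sum.cong)
    fix x assume x: "x \<in> X"
    have "{b\<in>L. b \<le> f x} = {b\<in>L. a \<le> b \<and> b \<le> f x}"
      using assms(5) by auto
    then show "(\<Sum>b\<in>L. if b \<le> f x then poset_moebius L a b else 0) = (if f x = a then 1 else 0)"
      using sum_poset_moebius[OF assms(1,2) assms(4)[OF x] assms(5)[OF assms(4)[OF x]]] assms(1)
      by (simp add: sum.If_cases Int_def)
  qed simp
  also have "\<dots> = int (card {x\<in>X. f x = a})"
    using assms(3) by (simp add: sum.If_cases Int_def)
  finally show ?thesis by simp
qed

section \<open>Closed balanced sets arising from points\<close>

text \<open>Potential differences telescope around a circle, which gives balance. For closure, the
  rest of a gain-0 circle through \<open>e\<close> fixes the potential difference across
  \<open>e\<close>, and it must equal the gain of \<open>e\<close>.\<close>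

lemma satisfied_edges_in_Latb: "{e\<in>E. satisfies x e} \<in> Latb E"
  unfolding Latb_def
proof (intro CollectI conjI)
  show "{e\<in>E. satisfies x e} \<subseteq> E" by blast
  show "balanced {e\<in>E. satisfies x e}"
    unfolding balanced_def
  proof (intro allI impI)
    fix p assume p: "circle p \<and> edges p \<subseteq> {e\<in>E. satisfies x e}"
    then obtain u where "walk u p u" by (auto simp: circle_def)
    then have "x u = x u + gain p"
      using p by (intro satisfies_walk) auto
    then show "gain p = 0" by simp
  qed
  show "closed_in E {e\<in>E. satisfies x e}"
    unfolding closed_in_def
  proof (intro ballI impI)
    fix e assume e: "e \<in> E"
    assume "\<exists>p. circle p \<and> gain p = 0 \<and> e \<in> edges p \<and> edges p \<subseteq> {e\<in>E. satisfies x e} \<union> {e}"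
    then obtain p where p: "circle p" "gain p = 0" "e \<in> edges p"
      "edges p \<subseteq> {e\<in>E. satisfies x e} \<union> {e}" by blast
    obtain d where d: "d \<in> set p" "e = dart_edge d"
      using p(3) by (auto simp: edges_def)
    then obtain a b where ab: "p = a @ d # b" by (meson split_list)
    obtain u where "walk u p u" using p(1) by (auto simp: circle_def)
    then have w: "walk u a (src d)" "walk (tgt d) b u"
      by (auto simp: ab walk_append)
    \<comment> \<open>A circle uses \<open>e\<close> only once, so every edge of \<open>a\<close>
      and \<open>b\<close> is already satisfied.\<close>
    have "distinct (map dart_edge p)" using p(1) by (simp add: circle_def)
    then have "e \<notin> edges a" "e \<notin> edges b"
      by (auto simp: ab d edges_def)
    then have r: "\<And>f. f \<in> edges a \<Longrightarrow> satisfies x f" "\<And>f. f \<in> edges b \<Longrightarrow> satisfies x f"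
      using p(4) by (auto simp: ab)
    have "x (src d) = x u + gain a" "x u = x (tgt d) + gain b"
      using satisfies_walk[OF w(1) r(1)] satisfies_walk[OF w(2) r(2)] by auto
    then have "satisfies x e"
      using p(2) by (simp add: d satisfies_dart_edge ab)
    then show "e \<in> {e\<in>E. satisfies x e}" using e by blast
  qed
qed

text \<open>Edges on a circle are distinct, so a circle inside a single edge has length 1 and is a
  loop. Without loops, no edge of \<open>E\<close> is forced into the closure of the empty
  set.\<close>

lemma empty_in_Latb:
  assumes "\<And>d. dart_edge d \<in> E \<Longrightarrow> src d \<noteq> tgt d"
  shows "{} \<in> Latb E"
proof -
  have "False" if e: "e \<in> E" and p: "circle p" "edges p \<subseteq> {e}" for e p
  proof -
    have "card (set (map dart_edge p)) = length p"
      using p(1) distinct_card[of "map dart_edge p"] by (simp add: circle_def)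
    moreover have "card (set (map dart_edge p)) \<le> card {e}"
      using p(2) by (intro card_mono) (auto simp: edges_def)
    ultimately have "length p \<le> 1" by simp
    moreover have "p \<noteq> []" using p(1) by (simp add: circle_def)
    ultimately obtain d where d: "p = [d]"
      by (cases p) auto
    then have "src d = tgt d" "dart_edge d = e"
      using p by (auto simp: circle_def)
    then show False using assms e by auto
  qed
  then show ?thesis
    by (auto simp: Latb_def balanced_def closed_in_def circle_def edges_def)
qed

lemma integral_gain_graph_no_loops:
  assumes "dart_edge d \<in> integral_gain_graph \<A>"
  shows "src d \<noteq> tgt d"
proof -
  obtain i a j where "i \<noteq> j" "dart_edge d = dart_edge (i, a, j)"
    using assms by (auto simp: integral_gain_graph_def)
  then show ?thesis
    by (auto simp: dart_edge_eq_iff rev_dart_def src_def tgt_def prod_eq_iff)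
qed

section \<open>From real hyperplanes to the gain graph\<close>

lemma affinographic_inject:
  assumes "i \<noteq> j" "affinographic i a j = affinographic i b j"
  shows "a = b"
proof -
  \<comment> \<open>The point with coordinate \<open>a\<close> at \<open>j\<close> and 0 elsewhere
    reveals the constant of the hyperplane.\<close>
  have "axis j (of_int a) \<in> affinographic i a j"
    using assms(1) by (simp add: affinographic_def axis_def)
  then have "axis j (of_int a) \<in> affinographic i b j"
    using assms(2) by simp
  then show ?thesis
    using assms(1) by (simp add: affinographic_def axis_def)
qed

lemma finite_integral_gain_graph:
  fixes \<A> :: "(real ^ 'n::finite) set set"
  assumes "finite \<A>"
  shows "finite (integral_gain_graph \<A>)"
proof -
  let ?D = "{(i, a, j). i \<noteq> j \<and> affinographic i a j \<in> \<A>}"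
  \<comment> \<open>The ends are recorded along with the hyperplane, since \<open>(i, a, j)\<close>
    and \<open>(j, -a, i)\<close> describe the same one.\<close>
  have "inj_on (\<lambda>(i, a, j). (i, j, affinographic i a j)) ?D"
    by (auto simp: inj_on_def dest: affinographic_inject)
  moreover have "(\<lambda>(i, a, j). (i, j, affinographic i a j)) ` ?D \<subseteq> UNIV \<times> UNIV \<times> \<A>"
    by auto
  moreover have "finite ((UNIV :: 'n set) \<times> (UNIV :: 'n set) \<times> \<A>)"
    using assms by simp
  ultimately have "finite ?D"
    by (rule inj_on_finite)
  moreover have "integral_gain_graph \<A> = dart_edge ` ?D"
    by (auto simp: integral_gain_graph_def)
  ultimately show ?thesis by simp
qed

text \<open>The embedding \<open>emb\<close> identifies integer-valued functions with integral real
  vectors and turns lying on a hyperplane into satisfying its edge. The rest of the count can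
  therefore stay within the integers.\<close>

lemma card_integer_points_avoiding:
  fixes m :: "nat ^ 'n::finite"
  assumes "\<And>H. H \<in> \<A> \<Longrightarrow> integral_affinographic H"
  shows "card {x \<in> cbox 0 (\<chi> i. real (m $ i)) - \<Union>\<A>. \<forall>i. x $ i \<in> \<int>} =
    card {x \<in> {x. \<forall>i. 0 \<le> x i \<and> x i \<le> int (m $ i)}.
            {e \<in> integral_gain_graph \<A>. satisfies x e} = {}}"
proof -
  define emb :: "('n \<Rightarrow> int) \<Rightarrow> real ^ 'n" where "emb x = (\<chi> i. of_int (x i))" for x
  let ?X = "{x \<in> {x. \<forall>i. 0 \<le> x i \<and> x i \<le> int (m $ i)}.
            {e \<in> integral_gain_graph \<A>. satisfies x e} = {}}"
  have "inj emb"
    by (auto simp: inj_def emb_def vec_eq_iff fun_eq_iff)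
  have aff: "emb x \<in> affinographic i a j \<longleftrightarrow> satisfies x (dart_edge (i, a, j))" for x i a j
    by (simp add: emb_def affinographic_def satisfies_dart_edge src_def tgt_def dart_gain_def
        flip: of_int_add)
  have avoid: "emb x \<notin> \<Union>\<A> \<longleftrightarrow> {e \<in> integral_gain_graph \<A>. satisfies x e} = {}" for x
  proof
    assume "emb x \<notin> \<Union>\<A>"
    then show "{e \<in> integral_gain_graph \<A>. satisfies x e} = {}"
      using aff by (auto simp: integral_gain_graph_def)
  next
    assume R: "{e \<in> integral_gain_graph \<A>. satisfies x e} = {}"
    show "emb x \<notin> \<Union>\<A>"
    proof
      assume "emb x \<in> \<Union>\<A>"
      then obtain H where H: "H \<in> \<A>" "emb x \<in> H" by blast
      then obtain i j a where "i \<noteq> j" "H = affinographic i a j"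
        using assms[OF H(1)] by (auto simp: integral_affinographic_def)
      then have "dart_edge (i, a, j) \<in> {e \<in> integral_gain_graph \<A>. satisfies x e}"
        using H aff by (auto simp: integral_gain_graph_def)
      with R show False by blast
    qed
  qed
  have box: "emb x \<in> cbox 0 (\<chi> i. real (m $ i)) \<longleftrightarrow> (\<forall>i. 0 \<le> x i \<and> x i \<le> int (m $ i))" for x
  proof -
    have "real_of_int (x i) \<le> real (m $ i) \<longleftrightarrow> x i \<le> int (m $ i)" for i
      by linarith
    then show ?thesis
      by (simp add: emb_def mem_box_cart)
  qed
  have "{x \<in> cbox 0 (\<chi> i. real (m $ i)) - \<Union>\<A>. \<forall>i. x $ i \<in> \<int>} = emb ` ?X"
  proof (intro equalityI subsetI)
    fix y assume y: "y \<in> {x \<in> cbox 0 (\<chi> i. real (m $ i)) - \<Union>\<A>. \<forall>i. x $ i \<in> \<int>}"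
    then obtain x where x: "y = emb x"
      \<comment> \<open>Each coordinate of \<open>y\<close> is an integer, so its floor recovers it
        exactly.\<close>
      using that[of "\<lambda>i. \<lfloor>y $ i\<rfloor>"] by (auto simp: emb_def vec_eq_iff)
    then have "x \<in> ?X"
      using y box[of x] avoid[of x] by blast
    then show "y \<in> emb ` ?X"
      using x by blast
  next
    fix y assume "y \<in> emb ` ?X"
    then obtain x where "x \<in> ?X" "y = emb x" by blast
    moreover have "emb x $ i \<in> \<int>" for i by (simp add: emb_def)
    ultimately show "y \<in> {x \<in> cbox 0 (\<chi> i. real (m $ i)) - \<Union>\<A>. \<forall>i. x $ i \<in> \<int>}"
      using box avoid by blast
  qed
  then show ?thesis
    using card_image[OF inj_on_subset[OF \<open>inj emb\<close> subset_UNIV], of ?X] by simp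
qed

section \<open>Summation over the closed balanced sets\<close>

theorem theorem5p19:
  fixes m :: "nat ^ 'n::finite"
    and \<A> :: "(real ^ 'n) set set"
    and t :: "'n edge set \<Rightarrow> 'n set \<Rightarrow> 'n"
  assumes "finite \<A>"
    and "\<And>H. H \<in> \<A> \<Longrightarrow> integral_affinographic H"
    and "\<And>B W. B \<in> Latb (integral_gain_graph \<A>) \<Longrightarrow> W \<in> components_partition B
           \<Longrightarrow> top_vertex B W (t B W)"
  shows "int (card {x \<in> cbox 0 (\<chi> i. real (m $ i)) - \<Union>\<A>. \<forall>i. x $ i \<in> \<int>}) =
    (\<Sum>B\<in>Latb (integral_gain_graph \<A>).
       poset_moebius (Latb (integral_gain_graph \<A>)) {} B *
       (\<Prod>W\<in>components_partition B.
          max 0 (1 + (MIN i\<in>W. int (m $ i) + path_gain B i (t B W)) - max_gain B W)))"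
proof -
  let ?E = "integral_gain_graph \<A>"
  let ?X = "{x. \<forall>i. 0 \<le> x i \<and> x i \<le> int (m $ i)}"
  let ?f = "\<lambda>x. {e \<in> ?E. satisfies x e}"
  have darts: "?E \<subseteq> range dart_edge"
    by (auto simp: integral_gain_graph_def)
  have "Latb ?E \<subseteq> Pow ?E"
    by (auto simp: Latb_def)
  then have finL: "finite (Latb ?E)"
    using finite_integral_gain_graph[OF assms(1)] by (meson finite_Pow_iff finite_subset)
  have "?X = PiE UNIV (\<lambda>i. {0..int (m $ i)})"
    by (auto simp: PiE_def)
  then have finX: "finite ?X"
    by (simp add: finite_PiE)
  \<comment> \<open>Inversion is applied to the map from a point to its set of satisfied edges, with
    the empty set as least element.\<close>
  have "int (card {x\<in>?X. ?f x = {}}) =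
      (\<Sum>B\<in>Latb ?E. poset_moebius (Latb ?E) {} B * int (card {x\<in>?X. B \<subseteq> ?f x}))"
    using finL finX empty_in_Latb[OF integral_gain_graph_no_loops] satisfied_edges_in_Latb
    by (intro moebius_inversion_count) auto
  also have "\<dots> = (\<Sum>B\<in>Latb ?E. poset_moebius (Latb ?E) {} B *
       (\<Prod>W\<in>components_partition B.
          max 0 (1 + (MIN i\<in>W. int (m $ i) + path_gain B i (t B W)) - max_gain B W)))"
  proof (rule sum.cong)
    fix B assume B: "B \<in> Latb ?E"
    then have B': "B \<subseteq> ?E" "balanced B" by (auto simp: Latb_def)
    \<comment> \<open>Having at least the edges of \<open>B\<close> satisfied means lying on all
      their hyperplanes, which is the situation counted by
      \<open>card_satisfying_box\<close>.\<close>
    then have "{x\<in>?X. B \<subseteq> ?f x} =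
        {x. (\<forall>i. 0 \<le> x i \<and> x i \<le> int (m $ i)) \<and> (\<forall>e\<in>B. satisfies x e)}"
      by auto
    then show "poset_moebius (Latb ?E) {} B * int (card {x\<in>?X. B \<subseteq> ?f x}) =
      poset_moebius (Latb ?E) {} B * (\<Prod>W\<in>components_partition B.
          max 0 (1 + (MIN i\<in>W. int (m $ i) + path_gain B i (t B W)) - max_gain B W))"
      using card_satisfying_box[of B "t B" "\<lambda>i. int (m $ i)"] B' darts assms(3)[OF B] by simp
  qed simp
  finally show ?thesis
    using card_integer_points_avoiding[OF assms(2)] by simp
qed

end
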